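(* Let $X$ be a Polish space which is not $\sigma$-compact and let $d$ be a compatible totally bounded metric on $X$. Then for every continuous function $f:X\to\mathbb R$ there exists a closed subset $P$ of $X$ homeomorphic to the irrationals $\mathbb N^{\mathbb N}$ such that $f$ restricted to $P$ is uniformly continuous with respect to the metric $d$. *)

theory Defs
  imports "HOL-Analysis.Analysis"
begin

text \<open>
  The class \<open>polish_space\<close> comes with a distinguished complete metric. Here a Polish
  space is a topological space only, so that the metric in the theorem may be any
  compatible, not necessarily complete, one.
\<close>

definition Polish_topology :: "'a topology \<Rightarrow> bool" where
  "Polish_topology X \<longleftrightarrow> completely_metrizable_space X \<and> separable_space X"

definition sigma_compact_topology :: "'a topology \<Rightarrow> bool" where
  "sigma_compact_topology X \<longleftrightarrow>
     (\<exists>\<K>. countable \<K> \<and> (\<forall>K\<in>\<K>. compactin X K) \<and> \<Union>\<K> = topspace X)"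

definition compatible_metric :: "'a topology \<Rightarrow> ('a \<Rightarrow> 'a \<Rightarrow> real) \<Rightarrow> bool" where
  "compatible_metric X d \<longleftrightarrow>
     Metric_space (topspace X) d \<and> Metric_space.mtopology (topspace X) d = X"

text \<open>The space of irrationals, presented as the countable power of discrete \<open>nat\<close>.\<close>

definition Baire_topology :: "(nat \<Rightarrow> nat) topology" where
  "Baire_topology = product_topology (\<lambda>_. discrete_topology UNIV) UNIV"

end

(*
  For some n the closed set {|f| <= n} is not sigma-compact; let S be the part of it that is
  nowhere covered by countably many compact sets. For a complete metric rho, no closed rho-ball
  of S is compact.
  By total boundedness each of them contains an injective sequence without limit point that is
  Cauchy for d and along which f is Cauchy. Small rho-balls around its terms are the children of
  the ball in a tree indexed by finite sequences of naturals; the branches of the tree form P.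
  Along the children of a node f has vanishing oscillation although they do not converge in X,
  which makes f uniformly continuous on P.
*)
theory Submission
  imports Defs
begin

section \<open>Trees of closed sets\<close>

text \<open>Two metrics share the work, and no compatible metric could do it alone: complete and
  totally bounded together would make the space compact. \<open>d\<close> supplies Cauchy sequences
  and measures uniform continuity; \<open>\<rho>\<close> makes the branches converge. The obstacle
  is that the centres of the children of a node are \<open>d\<close>-Cauchy, so no single positive
  distance separates all siblings. Separation is therefore asked only of one child against all
  others, and the tail of the children is controlled through \<open>f\<close>, whose values at the
  centres converge. That convergence comes from a subsequence argument, which is why
  \<open>f\<close> is first made bounded. The centres must avoid every point of the space, not just
  of \<open>P\<close>, for \<open>P\<close> to be closed. The kernel is needed because
  noncompactness has to recur in every ball around every point that is chosen later.\<close>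

lemma ex_common_radius:
  fixes Q :: "nat \<Rightarrow> real \<Rightarrow> bool"
  assumes "\<And>n r r'. Q n r \<Longrightarrow> 0 < r' \<Longrightarrow> r' \<le> r \<Longrightarrow> Q n r'"
    and "\<And>n. n < N \<Longrightarrow> \<exists>r>0. Q n r"
  shows "\<exists>r>0. \<forall>n<N. Q n r"
  using assms(2)
proof (induction N)
  case 0
  then show ?case by (auto intro: exI[of _ 1])
next
  case (Suc N)
  then obtain r r' where "r > 0" "\<forall>n<N. Q n r" "r' > 0" "Q N r'"
    by (metis less_Suc_eq)
  then have "\<forall>n<Suc N. Q n (min r r')"
    using assms(1) by (auto simp: less_Suc_eq)
  then show ?case
    using \<open>r > 0\<close> \<open>r' > 0\<close> by (intro exI[of _ "min r r'"]) auto
qed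

text \<open>Finite sequences are stored with the last entry first, so that a child of \<open>s\<close> is \<open>n # s\<close>.\<close>

primrec path :: "(nat \<Rightarrow> nat) \<Rightarrow> nat \<Rightarrow> nat list" where
  "path b 0 = []"
| "path b (Suc n) = b n # path b n"

lemma length_path [simp]: "length (path b n) = n"
  by (induction n) auto

lemma path_cong: "(\<And>i. i < n \<Longrightarrow> b i = c i) \<Longrightarrow> path b n = path c n"
  by (induction n) auto

text \<open>Dependent choice along the tree. It serves to push a defect (being approached by branch
  points, failing uniform continuity) from each node to some child and so along a whole
  branch.\<close>

lemma ex_path:
  assumes "Q []" and "\<And>s. Q s \<Longrightarrow> \<exists>n. Q (n # s)"
  shows "\<exists>b. \<forall>n. Q (path b n)"
proof -
  obtain c where c: "\<And>s. Q s \<Longrightarrow> Q (c s # s)"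
    using assms(2) by metis
  define t where "t = rec_nat [] (\<lambda>_ s. c s # s)"
  have t: "t 0 = []" "t (Suc n) = c (t n) # t n" for n
    by (simp_all add: t_def)
  have "path (\<lambda>n. c (t n)) n = t n" for n
    by (induction n) (simp_all add: t)
  moreover have "Q (t n)" for n
    by (induction n) (simp_all add: t assms(1) c)
  ultimately show ?thesis by metis
qed

text \<open>\<open>shrinking\<close> speaks of neighbourhoods instead of diameters, so no complete
  metric has to appear here. In \<open>separated\<close> the bound depends on \<open>n\<close> but
  serves all siblings \<open>m\<close>; it may tend to 0 as \<open>n\<close> grows.
  \<open>locally_finite\<close> is what yields closedness.\<close>

locale separated_scheme = Metric_space M d for M :: "'a set" and d +
  fixes F :: "nat list \<Rightarrow> 'a set"
  assumes closed: "closedin mtopology (F s)"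
    and nested: "F (n # s) \<subseteq> F s"
    and shrinking: "\<exists>x. (\<forall>n. x \<in> F (path b n)) \<and>
           (\<forall>V. openin mtopology V \<and> x \<in> V \<longrightarrow> (\<exists>n. F (path b n) \<subseteq> V))"
    and separated: "\<exists>\<delta>>0. \<forall>m. m \<noteq> n \<longrightarrow> (\<forall>x\<in>F (n # s). \<forall>y\<in>F (m # s). \<delta> \<le> d x y)"
    and locally_finite: "x \<in> M \<Longrightarrow> \<exists>\<delta>>0. \<exists>N. \<forall>n\<ge>N. \<forall>y\<in>F (n # s). \<delta> \<le> d x y"
begin

definition point :: "(nat \<Rightarrow> nat) \<Rightarrow> 'a" where
  "point b = (SOME x. (\<forall>n. x \<in> F (path b n)) \<and>
     (\<forall>V. openin mtopology V \<and> x \<in> V \<longrightarrow> (\<exists>n. F (path b n) \<subseteq> V)))"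

lemma point_in: "point b \<in> F (path b n)"
  and point_nbhd: "openin mtopology V \<Longrightarrow> point b \<in> V \<Longrightarrow> \<exists>n. F (path b n) \<subseteq> V"
  using someI_ex[OF shrinking[of b]] unfolding point_def by blast+

lemma node_subset: "F s \<subseteq> M"
  using closedin_subset[OF closed] by simp

lemma point_in_space: "point b \<in> M"
  using point_in node_subset by blast

text \<open>Membership in two different children of one node would make \<open>separated\<close>
  bound the distance of the point to itself below by a positive number.\<close>

lemma point_in_iff: "point b \<in> F s \<longleftrightarrow> path b (length s) = s"
proof
  show "point b \<in> F s \<Longrightarrow> path b (length s) = s"
  proof (induction s)
    case (Cons n s)
    then have s: "path b (length s) = s"
      using nested by blast
    have "b (length s) = n"
    proof (rule ccontr)
      assume "b (length s) \<noteq> n"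
      moreover have "point b \<in> F (b (length s) # s)"
        using point_in[of b "Suc (length s)"] s by simp
      ultimately show False
        using separated[of n s] Cons.prems point_in_space[of b] by fastforce
    qed
    with s show ?case by simp
  qed simp
qed (metis point_in)

lemma point_in_child: "point b \<in> F s \<Longrightarrow> \<exists>n. point b \<in> F (n # s)"
  by (metis point_in point_in_iff path.simps(2))

lemma range_point_root: "range point \<inter> F [] = range point"
  by (auto simp: point_in_iff)

lemma inj_point: "inj point"
proof (rule injI, rule ext)
  fix b c i
  assume "point b = point c"
  then have "path b (Suc i) = path c (Suc i)"
    by (metis point_in point_in_iff length_path)
  then show "b i = c i" by simp
qed

text \<open>The bound for a child is the smaller of the bound for its parent and the separation from
  its siblings: a nearby branch point first falls into the parent, then into some child, which must
  be the same one. This gives continuity of the inverse of \<open>point\<close>.\<close>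

lemma node_isolated:
  "\<exists>\<delta>>0. \<forall>x\<in>range point \<inter> F s. \<forall>y\<in>range point. d x y < \<delta> \<longrightarrow> y \<in> F s"
proof (induction s)
  case Nil
  show ?case
    by (auto simp: point_in_iff intro: exI[of _ 1])
next
  case (Cons n s)
  then obtain \<delta>1 where \<delta>1: "\<delta>1 > 0"
    "\<And>x y. x \<in> range point \<inter> F s \<Longrightarrow> y \<in> range point \<Longrightarrow> d x y < \<delta>1 \<Longrightarrow> y \<in> F s"
    by blast
  obtain \<delta>2 where \<delta>2: "\<delta>2 > 0"
    "\<And>m x y. m \<noteq> n \<Longrightarrow> x \<in> F (n # s) \<Longrightarrow> y \<in> F (m # s) \<Longrightarrow> \<delta>2 \<le> d x y"
    using separated by meson
  have "y \<in> F (n # s)"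
    if xy: "x \<in> range point \<inter> F (n # s)" "y \<in> range point" "d x y < min \<delta>1 \<delta>2" for x y
  proof -
    have "y \<in> F s"
      using \<delta>1(2)[of x y] xy nested by auto
    then obtain m where "y \<in> F (m # s)"
      using point_in_child xy(2) by blast
    then show ?thesis
      using \<delta>2(2)[of m x y] xy by fastforce
  qed
  then show ?case
    using \<delta>1(1) \<delta>2(1) by (intro exI[of _ "min \<delta>1 \<delta>2"]) auto
qed

text \<open>By local finiteness, a point adherent to the trace of a node is adherent to the trace of
  some child. The resulting branch has closed nodes, so they all contain the point, and they shrink
  to \<open>point b\<close>.\<close>

lemma closedin_range_point: "closedin mtopology (range point)"
proof -
  have "x \<in> range point" if x: "x \<in> mtopology closure_of range point" for x
  proof -
    have xM: "x \<in> M"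
      using x by (simp add: metric_closure_of)
    define Q where "Q s \<longleftrightarrow> (\<forall>r>0. \<exists>y\<in>range point \<inter> F s. d x y < r)" for s
    have "\<exists>b. \<forall>n. Q (path b n)"
    proof (rule ex_path)
      show "Q []"
        using x unfolding Q_def range_point_root metric_closure_of by (auto simp del: image_iff)
    next
      fix s assume Qs: "Q s"
      show "\<exists>n. Q (n # s)"
      proof (rule ccontr)
        assume "\<nexists>n. Q (n # s)"
        then have *: "\<exists>r>0. \<forall>y\<in>range point \<inter> F (n # s). r \<le> d x y" for n
          by (force simp: Q_def not_less)
        obtain \<delta> N where \<delta>: "\<delta> > 0" "\<And>n y. n \<ge> N \<Longrightarrow> y \<in> F (n # s) \<Longrightarrow> \<delta> \<le> d x y"
          using locally_finite[OF xM] by metis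
        have "\<exists>r>0. \<forall>n<N. \<forall>y\<in>range point \<inter> F (n # s). r \<le> d x y"
          by (rule ex_common_radius, meson order_trans, rule *)
        then obtain r where r: "r > 0"
          "\<And>n y. n < N \<Longrightarrow> y \<in> range point \<inter> F (n # s) \<Longrightarrow> r \<le> d x y"
          by blast
        obtain y where y: "y \<in> range point \<inter> F s" "d x y < min r \<delta>"
          using Qs \<delta>(1) r(1) unfolding Q_def by (metis min_less_iff_conj)
        then obtain n where "y \<in> F (n # s)"
          using point_in_child by blast
        then show False
          using y \<delta>(2)[of n y] r(2)[of n y] by (cases "n < N") auto
      qed
    qed
    then obtain b where b: "\<And>n. Q (path b n)" by blast
    have xF: "x \<in> F (path b n)" for n
    proof -
      have "\<exists>y\<in>F (path b n). y \<in> mball x r" if "r > 0" for r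
      proof -
        obtain y where "y \<in> F (path b n)" "d x y < r"
          using b[of n] \<open>r > 0\<close> unfolding Q_def by blast
        then show ?thesis
          using xM node_subset by auto
      qed
      then have "x \<in> mtopology closure_of F (path b n)"
        using xM unfolding metric_closure_of by simp
      then show ?thesis
        using closed by (simp add: closure_of_closedin)
    qed
    have "x = point b"
    proof (rule ccontr)
      assume "x \<noteq> point b"
      \<comment> \<open>This ball omits \<open>x\<close>, although \<open>x\<close> lies in every
        node of the branch.\<close>
      then have "point b \<in> mball (point b) (d (point b) x)"
        using point_in_space xM by simp
      then obtain n where "F (path b n) \<subseteq> mball (point b) (d (point b) x)"
        using point_nbhd openin_mball by blast
      then show False
        using xF[of n] by auto
    qed
    then show ?thesis by blast
  qed
  then show ?thesis
    using point_in_space closure_of_subset_eq by fastforce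
qed

lemma homeomorphic_Baire:
  "subtopology mtopology (range point) homeomorphic_space Baire_topology"
proof -
  have "continuous_map Baire_topology mtopology point"
    unfolding continuous_map_def
  proof (intro conjI allI impI)
    show "point \<in> topspace Baire_topology \<rightarrow> topspace mtopology"
      using point_in_space by simp
    fix V assume V: "openin mtopology V"
    have "\<exists>T. openin Baire_topology T \<and> b \<in> T \<and> T \<subseteq> {b. point b \<in> V}"
      if "point b \<in> V" for b
    proof -
      obtain n where n: "F (path b n) \<subseteq> V"
        using point_nbhd V \<open>point b \<in> V\<close> by blast
      \<comment> \<open>The basic cylinder of the sequences that agree with \<open>b\<close> in the
        first \<open>n\<close> entries.\<close>
      define T where "T = (\<Pi>\<^sub>E i\<in>UNIV. if i < n then {b i} else UNIV)"
      have "openin Baire_topology T"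
        unfolding T_def Baire_topology_def
      proof (rule product_topology_basis)
        show "openin (discrete_topology UNIV) (if i < n then {b i} else UNIV)" for i
          by simp
        have "{i. (if i < n then {b i} else UNIV) \<noteq> topspace (discrete_topology UNIV)} \<subseteq> {..<n}"
          by auto
        then show "finite {i. (if i < n then {b i} else UNIV) \<noteq> topspace (discrete_topology UNIV)}"
          using finite_subset by blast
      qed
      moreover have "b \<in> T"
        by (auto simp: T_def PiE_iff)
      moreover have "point c \<in> V" if "c \<in> T" for c
      proof -
        have "c i = b i" if "i < n" for i
          using PiE_mem[OF \<open>c \<in> T\<close>[unfolded T_def], of i] that by simp
        then have "path c n = path b n"
          by (rule path_cong)
        then show ?thesis
          using n point_in[of c n] by auto
      qed
      ultimately show ?thesis by blast
    qed
    then have "openin Baire_topology {b. point b \<in> V}"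
      by (subst openin_subopen) blast
    then show "openin Baire_topology {b \<in> topspace Baire_topology. point b \<in> V}"
      by (simp add: Baire_topology_def)
  qed
  moreover have "continuous_map (subtopology mtopology (range point)) Baire_topology (inv point)"
    unfolding Baire_topology_def continuous_map_componentwise_UNIV
    unfolding continuous_map_def
  proof (intro allI conjI impI)
    fix i and U :: "nat set"
    show "(\<lambda>x. inv point x i) \<in> topspace (subtopology mtopology (range point))
        \<rightarrow> topspace (discrete_topology UNIV)"
      by simp
    define W where "W = {x \<in> range point. inv point x i \<in> U}"
    have "openin (subtopology mtopology (range point)) W"
    proof (subst openin_subopen, rule ballI)
      fix x assume "x \<in> W"
      obtain b where b: "x = point b" "b i \<in> U"
        using \<open>x \<in> W\<close> inj_point by (auto simp: W_def)
      \<comment> \<open>Entry \<open>i\<close> is determined by the node at level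
        \<open>Suc i\<close>, not \<open>i\<close>.\<close>
      obtain \<delta> where \<delta>: "\<delta> > 0"
        "\<And>y. y \<in> range point \<Longrightarrow> d x y < \<delta> \<Longrightarrow> y \<in> F (path b (Suc i))"
        using node_isolated[of "path b (Suc i)"] point_in[of b "Suc i"] b(1) by blast
      have "inv point y i \<in> U" if y: "y \<in> range point" "d x y < \<delta>" for y
      proof -
        obtain c where c: "y = point c"
          using y(1) by blast
        then have "path c (Suc i) = path b (Suc i)"
          using \<delta>(2)[OF y] point_in_iff by (metis length_path)
        then show ?thesis
          using b(2) c inj_point by simp
      qed
      then have "range point \<inter> mball x \<delta> \<subseteq> W"
        by (auto simp: W_def)
      moreover have "x \<in> range point \<inter> mball x \<delta>"
        using b(1) \<delta>(1) point_in_space by simp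
      ultimately show "\<exists>T. openin (subtopology mtopology (range point)) T \<and> x \<in> T \<and> T \<subseteq> W"
        using openin_subtopology_Int2[OF openin_mball] by metis
    qed
    moreover have "{x \<in> topspace (subtopology mtopology (range point)). inv point x i \<in> U} = W"
      using point_in_space by (auto simp: W_def)
    ultimately show "openin (subtopology mtopology (range point))
        {x \<in> topspace (subtopology mtopology (range point)). inv point x i \<in> U}"
      by simp
  qed
  ultimately have "homeomorphic_maps (subtopology mtopology (range point)) Baire_topology
      (inv point) point"
    using inj_point by (auto simp: homeomorphic_maps_def continuous_map_in_subtopology f_inv_into_f)
  then show ?thesis
    by (auto simp: homeomorphic_space_def)
qed

text \<open>
  A node on which uniform continuity fails for \<open>\<epsilon>\<close> has a child with the same defect: all but
  finitely many children together carry an oscillation below \<open>\<epsilon>\<close>, and distinct children lie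
  a positive distance apart. The branch obtained in this way contradicts the continuity of \<open>f\<close>.
\<close>

lemma uniformly_continuous_on_range_point:
  fixes f :: "'a \<Rightarrow> real"
  assumes f: "continuous_map mtopology euclideanreal f"
    and tail: "\<And>s \<epsilon>. \<epsilon> > 0 \<Longrightarrow>
      \<exists>N. \<forall>m\<ge>N. \<forall>n\<ge>N. \<forall>x\<in>F (m # s). \<forall>y\<in>F (n # s). \<bar>f x - f y\<bar> < \<epsilon>"
    and "\<epsilon> > 0"
  shows "\<exists>\<delta>>0. \<forall>x\<in>range point. \<forall>y\<in>range point. d x y < \<delta> \<longrightarrow> \<bar>f x - f y\<bar> < \<epsilon>"
proof (rule ccontr)
  define good where "good s \<delta> \<longleftrightarrow>
    (\<forall>x\<in>range point \<inter> F s. \<forall>y\<in>range point \<inter> F s. d x y < \<delta> \<longrightarrow> \<bar>f x - f y\<bar> < \<epsilon>)" for s \<delta>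
  define bad where "bad s \<longleftrightarrow> \<not> (\<exists>\<delta>>0. good s \<delta>)" for s
  assume neg: "\<not> ?thesis"
  have "\<exists>b. \<forall>n. bad (path b n)"
  proof (rule ex_path)
    show "bad []"
      using neg unfolding bad_def good_def range_point_root .
  next
    fix s assume "bad s"
    show "\<exists>n. bad (n # s)"
    proof (rule ccontr)
      assume "\<nexists>n. bad (n # s)"
      then have *: "\<exists>\<delta>>0. good (n # s) \<delta>" for n
        by (auto simp: bad_def)
      obtain N where N: "\<And>m n x y. m \<ge> N \<Longrightarrow> n \<ge> N \<Longrightarrow> x \<in> F (m # s) \<Longrightarrow> y \<in> F (n # s)
          \<Longrightarrow> \<bar>f x - f y\<bar> < \<epsilon>"
        using tail[OF \<open>\<epsilon> > 0\<close>] by metis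
      have "\<exists>\<delta>>0. \<forall>n<N. good (n # s) \<delta>"
      proof (rule ex_common_radius)
        show "good (n # s) r'" if "good (n # s) r" "r' \<le> r" for n r r'
          using that unfolding good_def by (meson less_le_trans)
      qed (rule *)
      then obtain \<delta>1 where \<delta>1: "\<delta>1 > 0" "\<And>n. n < N \<Longrightarrow> good (n # s) \<delta>1"
        by blast
      \<comment> \<open>Only \<open>n\<close> is bounded by \<open>N\<close>; the constant must also
        work against the infinitely many siblings \<open>m\<close> beyond \<open>N\<close>.\<close>
      have "\<exists>\<delta>>0. \<forall>n<N. \<forall>m. m \<noteq> n \<longrightarrow> (\<forall>x\<in>F (n # s). \<forall>y\<in>F (m # s). \<delta> \<le> d x y)"
      proof (rule ex_common_radius)
        show "\<forall>m. m \<noteq> n \<longrightarrow> (\<forall>x\<in>F (n # s). \<forall>y\<in>F (m # s). r' \<le> d x y)"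
          if "\<forall>m. m \<noteq> n \<longrightarrow> (\<forall>x\<in>F (n # s). \<forall>y\<in>F (m # s). r \<le> d x y)" "r' \<le> r" for n r r'
          using that by (meson order_trans)
      qed (rule separated)
      then obtain \<delta>2 where \<delta>2: "\<delta>2 > 0"
        "\<forall>n<N. \<forall>m. m \<noteq> n \<longrightarrow> (\<forall>x\<in>F (n # s). \<forall>y\<in>F (m # s). \<delta>2 \<le> d x y)"
        by blast
      have "good s (min \<delta>1 \<delta>2)"
        unfolding good_def
      proof (intro ballI impI)
        fix x y assume x: "x \<in> range point \<inter> F s" and y: "y \<in> range point \<inter> F s"
          and dxy: "d x y < min \<delta>1 \<delta>2"
        obtain m n where m: "x \<in> F (m # s)" and n: "y \<in> F (n # s)"
          using x y point_in_child by blast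
        consider "m \<ge> N" "n \<ge> N" | "m < N" "m = n" | "m < N" "m \<noteq> n" | "n < N" "m \<noteq> n"
          by linarith
        then show "\<bar>f x - f y\<bar> < \<epsilon>"
        proof cases
          case 1
          then show ?thesis using N m n by blast
        next
          case 2
          then show ?thesis
            using \<delta>1(2)[of m] x y m n dxy by (auto simp: good_def)
        next
          case 3
          then show ?thesis using \<delta>2(2)[rule_format, of m n x y] m n dxy by auto
        next
          case 4
          then show ?thesis using \<delta>2(2)[rule_format, of n m y x] m n dxy by (simp add: commute)
        qed
      qed
      then show False
        using \<open>bad s\<close> \<delta>1(1) \<delta>2(1) by (auto simp: bad_def)
    qed
  qed
  then obtain b where b: "\<And>n. bad (path b n)" by blast
  define V where "V = {x \<in> M. f x \<in> ball (f (point b)) (\<epsilon> / 2)}"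
  have "openin mtopology V"
    unfolding V_def using openin_continuous_map_preimage[OF f, of "ball (f (point b)) (\<epsilon> / 2)"] by simp
  moreover have "point b \<in> V"
    using point_in_space \<open>\<epsilon> > 0\<close> by (simp add: V_def)
  ultimately obtain n where n: "F (path b n) \<subseteq> V"
    using point_nbhd by blast
  \<comment> \<open>The value 1 is arbitrary: on this node any two values of \<open>f\<close> are
    within \<open>\<epsilon> / 2\<close> of \<open>f (point b)\<close>.\<close>
  have "good (path b n) 1"
    unfolding good_def
  proof (intro ballI impI)
    fix x y assume "x \<in> range point \<inter> F (path b n)" "y \<in> range point \<inter> F (path b n)"
    then have "x \<in> V" "y \<in> V" using n by auto
    then have "\<bar>f (point b) - f x\<bar> < \<epsilon> / 2" "\<bar>f (point b) - f y\<bar> < \<epsilon> / 2"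
      by (simp_all add: V_def dist_real_def)
    then show "\<bar>f x - f y\<bar> < \<epsilon>"
      by linarith
  qed
  then show False
    using b[of n] by (auto simp: bad_def intro: exI[of _ 1])
qed

end

section \<open>Diverging Cauchy sequences\<close>

context Metric_space
begin

text \<open>The base consists of the balls of radius \<open>1/(n+1)\<close> around finite nets. The
  kernel construction uses it to reduce a union of open sets to a countable one.\<close>

lemma mtotally_bounded_imp_second_countable:
  assumes "mtotally_bounded M"
  shows "second_countable mtopology"
proof -
  have "\<exists>K. finite K \<and> K \<subseteq> M \<and> M \<subseteq> (\<Union>x\<in>K. mball x (inverse (real (Suc n))))" for n
    using assms unfolding mtotally_bounded_def by (simp del: of_nat_Suc)
  then obtain K where K: "\<And>n. finite (K n)" "\<And>n. M \<subseteq> (\<Union>x\<in>K n. mball x (inverse (real (Suc n))))"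
    by metis
  define \<B> where "\<B> = (\<Union>n. (\<lambda>x. mball x (inverse (real (Suc n)))) ` K n)"
  have "\<exists>V\<in>\<B>. x \<in> V \<and> V \<subseteq> U" if U: "openin mtopology U" "x \<in> U" for U x
  proof -
    obtain r where r: "r > 0" "mball x r \<subseteq> U"
      using U by (auto simp: openin_mtopology)
    obtain n where n: "inverse (real (Suc n)) < r / 2"
      using reals_Archimedean[of "r / 2"] r(1) by auto
    have "x \<in> M"
      using U by (auto simp: openin_mtopology)
    then obtain c where c: "c \<in> K n" "x \<in> mball c (inverse (real (Suc n)))"
      using K(2) by blast
    have "mball c (inverse (real (Suc n))) \<subseteq> mball x r"
    proof
      fix z assume z: "z \<in> mball c (inverse (real (Suc n)))"
      then have "d x z \<le> d c x + d c z"
        using c(2) triangle[of x c z] by (simp add: commute)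
      then show "z \<in> mball x r"
        using z c(2) n by auto
    qed
    then show ?thesis
      using c r(2) by (intro bexI[of _ "mball c (inverse (real (Suc n)))"]) (auto simp: \<B>_def)
  qed
  moreover have "countable \<B>"
    unfolding \<B>_def using K(1) by (intro countable_UN) (auto intro: countable_finite)
  moreover have "\<forall>V\<in>\<B>. openin mtopology V"
    by (auto simp: \<B>_def)
  ultimately show ?thesis
    unfolding second_countable_def by blast
qed

text \<open>Three extractions: noncompactness gives a sequence without convergent subsequence, total
  boundedness a Cauchy subsequence, and boundedness of \<open>f\<close> one along which
  \<open>f\<close> converges. A fourth makes it injective.\<close>

lemma ex_diverging_sequence:
  fixes f :: "'a \<Rightarrow> real"
  assumes C: "closedin mtopology C" "\<not> compactin mtopology C" "mtotally_bounded C"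
    and f: "bounded (f ` C)"
  obtains y :: "nat \<Rightarrow> 'a" where "range y \<subseteq> C" "inj y" "Cauchy (\<lambda>n. f (y n))"
    "\<And>p. p \<in> M \<Longrightarrow> \<exists>\<delta>>0. \<exists>N. \<forall>n\<ge>N. \<delta> \<le> d p (y n)"
proof -
  have CM: "C \<subseteq> M"
    using C(1) closedin_subset by force
  obtain \<sigma> :: "nat \<Rightarrow> 'a" where \<sigma>: "range \<sigma> \<subseteq> C"
    "\<And>l r. l \<in> C \<Longrightarrow> strict_mono r \<Longrightarrow> \<not> limitin mtopology (\<sigma> \<circ> r) l sequentially"
    using C(2) CM by (auto simp: compactin_sequentially)
  obtain r where r: "strict_mono r" "MCauchy (\<sigma> \<circ> r)"
    using C(3) \<sigma>(1) unfolding mtotally_bounded_sequentially by blast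
  have "bounded (range (\<lambda>n. f (\<sigma> (r n))))"
    by (rule bounded_subset[OF f]) (use \<sigma>(1) in auto)
  then obtain l r' where r': "strict_mono r'" "((\<lambda>n. f (\<sigma> (r n))) \<circ> r') \<longlonglongrightarrow> l"
    using bounded_imp_convergent_subsequence by blast
  define t where "t = \<sigma> \<circ> (r \<circ> r')"
  have t: "range t \<subseteq> C" "MCauchy t"
    using \<sigma>(1) MCauchy_subsequence[OF r'(1) r(2)] by (auto simp: t_def o_assoc)
  \<comment> \<open>A Cauchy sequence that clusters at \<open>p\<close> converges to
    \<open>p\<close>; as \<open>C\<close> is closed, the limit would lie in \<open>C\<close>, which
    the choice of \<open>\<sigma>\<close> excludes.\<close>
  have away: "\<exists>\<delta>>0. \<exists>N. \<forall>n\<ge>N. \<delta> \<le> d p (t n)" if p: "p \<in> M" for p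
  proof (rule ccontr)
    assume "\<not> ?thesis"
    then have *: "\<exists>n\<ge>N. d p (t n) < \<delta>" if "\<delta> > 0" for \<delta> N
      using that by (meson not_less)
    have "\<exists>N. \<forall>m\<ge>N. t m \<in> M \<and> d (t m) p < \<epsilon>" if "\<epsilon> > 0" for \<epsilon>
    proof -
      obtain N where N: "\<And>m n. N \<le> m \<Longrightarrow> N \<le> n \<Longrightarrow> d (t m) (t n) < \<epsilon> / 2"
        using t(2) \<open>\<epsilon> > 0\<close> half_gt_zero unfolding MCauchy_def by blast
      obtain n where n: "n \<ge> N" "d p (t n) < \<epsilon> / 2"
        using *[of "\<epsilon> / 2" N] \<open>\<epsilon> > 0\<close> by auto
      have tM: "t m \<in> M" for m
        using t(1) CM by auto
      have "d (t m) p < \<epsilon>" if "m \<ge> N" for m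
        using N[OF that n(1)] n(2) triangle[OF tM[of m] tM[of n] p] by (simp add: commute)
      with tM show ?thesis by blast
    qed
    then have lim: "limitin mtopology t p sequentially"
      using p by (simp add: limit_metric_sequentially)
    then have "p \<in> C"
      using C(1) t(1) by (auto simp: metric_closedin_iff_sequentially_closed)
    then show False
      using \<sigma>(2)[of p "r \<circ> r'"] lim r(1) r'(1) by (auto simp: t_def strict_mono_o)
  qed
  \<comment> \<open>Applying \<open>away\<close> to the term \<open>t n\<close> itself shows that
    its value eventually stops recurring.\<close>
  have "\<exists>N. \<forall>m\<ge>N. t m \<noteq> t n" for n
  proof -
    have "t n \<in> M"
      using t(1) CM by auto
    then show ?thesis
      using away[of "t n"] by force
  qed
  then obtain N where N: "\<And>m n. m \<ge> N n \<Longrightarrow> t m \<noteq> t n"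
    by metis
  define h where "h = rec_nat 0 (\<lambda>_ k. max (Suc k) (N k))"
  have h: "h (Suc n) = max (Suc (h n)) (N (h n))" for n
    by (simp add: h_def)
  have mono: "strict_mono h"
    by (simp add: strict_mono_Suc_iff h less_max_iff_disj)
  have *: "t (h j) \<noteq> t (h i)" if "i < j" for i j
  proof (rule N)
    have "N (h i) \<le> h (Suc i)"
      by (simp add: h)
    also have "\<dots> \<le> h j"
      using that mono by (simp add: strict_mono_less_eq)
    finally show "N (h i) \<le> h j" .
  qed
  have "range (t \<circ> h) \<subseteq> C"
    using t(1) by auto
  moreover from * have "inj (t \<circ> h)"
    by (metis comp_apply injI linorder_neqE_nat)
  moreover have "Cauchy (\<lambda>n. f ((t \<circ> h) n))"
    using LIMSEQ_subseq_LIMSEQ[OF r'(2) mono]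
    by (intro LIMSEQ_imp_Cauchy) (simp add: t_def o_def)
  moreover have "\<exists>\<delta>>0. \<exists>N. \<forall>n\<ge>N. \<delta> \<le> d p ((t \<circ> h) n)" if p: "p \<in> M" for p
  proof -
    obtain \<delta> N where "\<delta> > 0" "\<forall>n\<ge>N. \<delta> \<le> d p (t n)"
      using away[OF p] by blast
    moreover have "n \<le> h n" for n
      by (rule seq_suble[OF mono])
    ultimately have "\<delta> > 0 \<and> (\<forall>n\<ge>N. \<delta> \<le> d p ((t \<circ> h) n))"
      by (auto intro: order_trans)
    then show ?thesis by blast
  qed
  ultimately show thesis
    by (rule that)
qed

text \<open>The clauses are \<open>separated\<close>, \<open>locally_finite\<close> and the
  \<open>tail\<close> condition for the children of one node, stated for any sequence of sets so
  that radii can be found before there is a tree.\<close>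

definition scattered :: "('a \<Rightarrow> real) \<Rightarrow> (nat \<Rightarrow> 'a set) \<Rightarrow> bool" where
  "scattered f G \<longleftrightarrow>
      (\<forall>n. \<exists>\<delta>>0. \<forall>m. m \<noteq> n \<longrightarrow> (\<forall>x\<in>G n. \<forall>x'\<in>G m. \<delta> \<le> d x x')) \<and>
      (\<forall>p\<in>M. \<exists>\<delta>>0. \<exists>N. \<forall>n\<ge>N. \<forall>x\<in>G n. \<delta> \<le> d p x) \<and>
      (\<forall>\<epsilon>>0. \<exists>N. \<forall>m\<ge>N. \<forall>n\<ge>N. \<forall>x\<in>G m. \<forall>x'\<in>G n. \<bar>f x - f x'\<bar> < \<epsilon>)"

text \<open>The radii depend on the centres only, and every family of smaller sets qualifies. This
  leaves room to fit \<open>\<rho>\<close>-balls inside later.\<close>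

lemma ex_separating_radii:
  fixes f :: "'a \<Rightarrow> real" and y :: "nat \<Rightarrow> 'a"
  assumes y: "range y \<subseteq> M" "inj y" and f: "Cauchy (\<lambda>n. f (y n))"
    and away: "\<forall>p\<in>M. \<exists>\<delta>>0. \<exists>N. \<forall>n\<ge>N. \<delta> \<le> d p (y n)"
  obtains e :: "nat \<Rightarrow> real" where "\<And>n. e n > 0"
    and "\<And>G. (\<And>n. G n \<subseteq> {x \<in> M. d (y n) x < e n \<and> \<bar>f x - f (y n)\<bar> < e n}) \<Longrightarrow>
      scattered f G"
proof -
  have yM: "y n \<in> M" for n
    using y(1) by auto
  have "\<exists>s>0. \<forall>m. m \<noteq> n \<longrightarrow> s \<le> d (y n) (y m)" for n
  proof -
    obtain \<delta> N where \<delta>: "\<delta> > 0" "\<And>m. m \<ge> N \<Longrightarrow> \<delta> \<le> d (y n) (y m)"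
      using away[rule_format, OF yM[of n]] by blast
    have "\<exists>s>0. \<forall>m<N. m \<noteq> n \<longrightarrow> s \<le> d (y n) (y m)"
    proof (rule ex_common_radius, meson order_trans)
      fix m
      show "\<exists>s>0. m \<noteq> n \<longrightarrow> s \<le> d (y n) (y m)"
      proof (cases "m = n")
        case False
        then have "y n \<noteq> y m"
          using y(2) by (auto dest: injD)
        then have "d (y n) (y m) > 0"
          using yM by simp
        then show ?thesis by blast
      qed (auto intro: exI[of _ 1])
    qed
    then obtain s where s: "s > 0" "\<And>m. m < N \<Longrightarrow> m \<noteq> n \<Longrightarrow> s \<le> d (y n) (y m)"
      by blast
    have "min s \<delta> \<le> d (y n) (y m)" if "m \<noteq> n" for m
      using s(2)[of m] \<delta>(2)[of m] that by (cases "m < N") auto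
    then show ?thesis
      using s(1) \<delta>(1) by (intro exI[of _ "min s \<delta>"]) auto
  qed
  then obtain s where s: "\<And>n. s n > 0" "\<And>m n. m \<noteq> n \<Longrightarrow> s n \<le> d (y n) (y m)"
    by metis
  \<comment> \<open>Taking \<open>s n / 3\<close> and \<open>s m / 3\<close> off a distance that is
    at least \<open>s n\<close> and \<open>s m\<close> leaves at least \<open>s n / 3\<close>. The
    term \<open>1/(n+1)\<close> makes the radii vanish, as the other two clauses require.\<close>
  define e where "e n = min (inverse (real (Suc n))) (s n / 3)" for n
  show thesis
  proof
    show "e n > 0" for n
      using s(1) by (simp add: e_def)
    fix G :: "nat \<Rightarrow> 'a set"
    assume G: "\<And>n. G n \<subseteq> {x \<in> M. d (y n) x < e n \<and> \<bar>f x - f (y n)\<bar> < e n}"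
    have small: "\<exists>N. \<forall>n\<ge>N. e n < \<epsilon>" if "\<epsilon> > 0" for \<epsilon>
    proof -
      obtain N where N: "inverse (real (Suc N)) < \<epsilon>"
        using reals_Archimedean[OF \<open>\<epsilon> > 0\<close>] by blast
      have "e n < \<epsilon>" if "n \<ge> N" for n
      proof -
        have "e n \<le> inverse (real (Suc n))"
          by (simp add: e_def)
        also have "\<dots> \<le> inverse (real (Suc N))"
          using that by (intro le_imp_inverse_le) auto
        finally show ?thesis using N by linarith
      qed
      then show ?thesis by blast
    qed
    have "\<exists>\<delta>>0. \<forall>m. m \<noteq> n \<longrightarrow> (\<forall>x\<in>G n. \<forall>x'\<in>G m. \<delta> \<le> d x x')" for n
    proof (intro exI conjI strip)
      show "s n / 3 > 0"
        using s(1) by simp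
      fix m x x' assume mn: "m \<noteq> n" and x: "x \<in> G n" and x': "x' \<in> G m"
      have "x \<in> M" "x' \<in> M" "d (y n) x < s n / 3" "d (y m) x' < s m / 3"
        using x x' G[of n] G[of m] by (auto simp: e_def)
      moreover have "s n \<le> d (y n) (y m)" "s m \<le> d (y n) (y m)"
        using s(2)[of m n] s(2)[of n m] mn by (auto simp: commute)
      moreover have "d (y n) (y m) \<le> d (y n) x + d x x' + d (y m) x'"
        using triangle[OF yM[of n] \<open>x \<in> M\<close> yM[of m]] triangle[OF \<open>x \<in> M\<close> \<open>x' \<in> M\<close> yM[of m]]
        by (simp add: commute)
      ultimately show "s n / 3 \<le> d x x'" by linarith
    qed
    moreover have "\<exists>\<delta>>0. \<exists>N. \<forall>n\<ge>N. \<forall>x\<in>G n. \<delta> \<le> d p x" if p: "p \<in> M" for p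
    proof -
      obtain \<delta> N where \<delta>: "\<delta> > 0" "\<And>n. n \<ge> N \<Longrightarrow> \<delta> \<le> d p (y n)"
        using away[rule_format, OF p] by blast
      obtain N' where N': "\<And>n. n \<ge> N' \<Longrightarrow> e n < \<delta> / 2"
        using small[of "\<delta> / 2"] \<delta>(1) by auto
      have "\<delta> / 2 \<le> d p x" if n: "n \<ge> max N N'" and x: "x \<in> G n" for n x
      proof -
        have "x \<in> M" "d (y n) x < \<delta> / 2"
          using G[of n] x N'[of n] n by auto
        then show ?thesis
          using \<delta>(2)[of n] n triangle[OF p \<open>x \<in> M\<close> yM[of n]] by (simp add: commute)
      qed
      then show ?thesis
        using \<delta>(1) half_gt_zero by blast
    qed
    moreover have "\<exists>N. \<forall>m\<ge>N. \<forall>n\<ge>N. \<forall>x\<in>G m. \<forall>x'\<in>G n. \<bar>f x - f x'\<bar> < \<epsilon>" if "\<epsilon> > 0" for \<epsilon>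
    proof -
      obtain N where N: "\<And>n. n \<ge> N \<Longrightarrow> e n < \<epsilon> / 3"
        using small[of "\<epsilon> / 3"] \<open>\<epsilon> > 0\<close> by auto
      obtain N' where N': "\<And>m n. m \<ge> N' \<Longrightarrow> n \<ge> N' \<Longrightarrow> \<bar>f (y m) - f (y n)\<bar> < \<epsilon> / 3"
        using f \<open>\<epsilon> > 0\<close> unfolding Cauchy_def dist_real_def
        by (metis zero_less_divide_iff zero_less_numeral)
      have "\<bar>f x - f x'\<bar> < \<epsilon>"
        if "m \<ge> max N N'" "n \<ge> max N N'" "x \<in> G m" "x' \<in> G n" for m n x x'
      proof -
        have "\<bar>f x - f (y m)\<bar> < \<epsilon> / 3" "\<bar>f x' - f (y n)\<bar> < \<epsilon> / 3"
          using G[of m] G[of n] N[of m] N[of n] that by fastforce+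
        moreover have "\<bar>f (y m) - f (y n)\<bar> < \<epsilon> / 3"
          using N' that by simp
        ultimately show ?thesis by linarith
      qed
      then show ?thesis by blast
    qed
    ultimately show "scattered f G"
      unfolding scattered_def by blast
  qed
qed

end

section \<open>Sets covered by countably many compact sets\<close>

text \<open>A cover instead of an equality makes the notion hereditary; for the whole space it is
  sigma-compactness.\<close>

definition sigma_bounded :: "'a topology \<Rightarrow> 'a set \<Rightarrow> bool" where
  "sigma_bounded X A \<longleftrightarrow> (\<exists>\<K>. countable \<K> \<and> (\<forall>K\<in>\<K>. compactin X K) \<and> A \<subseteq> \<Union>\<K>)"

lemma sigma_bounded_subset: "sigma_bounded X B \<Longrightarrow> A \<subseteq> B \<Longrightarrow> sigma_bounded X A"
  unfolding sigma_bounded_def by (meson subset_trans)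

lemma sigma_bounded_compactin: "compactin X K \<Longrightarrow> sigma_bounded X K"
  unfolding sigma_bounded_def by (intro exI[of _ "{K}"]) auto

lemma sigma_bounded_UN:
  assumes "countable I" "\<And>i. i \<in> I \<Longrightarrow> sigma_bounded X (A i)"
  shows "sigma_bounded X (\<Union>i\<in>I. A i)"
proof -
  obtain \<K> where \<K>: "\<And>i. i \<in> I \<Longrightarrow> countable (\<K> i) \<and> (\<forall>K\<in>\<K> i. compactin X K) \<and> A i \<subseteq> \<Union>(\<K> i)"
    using assms(2) unfolding sigma_bounded_def by metis
  show ?thesis
    unfolding sigma_bounded_def
  proof (intro exI conjI)
    show "countable (\<Union>i\<in>I. \<K> i)"
      using assms(1) \<K> by (intro countable_UN) auto
    show "\<forall>K\<in>(\<Union>i\<in>I. \<K> i). compactin X K"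
      using \<K> by auto
    show "(\<Union>i\<in>I. A i) \<subseteq> \<Union>(\<Union>i\<in>I. \<K> i)"
    proof
      fix x assume "x \<in> (\<Union>i\<in>I. A i)"
      then obtain i where i: "i \<in> I" "x \<in> A i" by blast
      then obtain K where "K \<in> \<K> i" "x \<in> K"
        using \<K>[OF i(1)] by blast
      with i(1) show "x \<in> \<Union>(\<Union>i\<in>I. \<K> i)" by blast
    qed
  qed
qed

lemma sigma_bounded_topspace: "sigma_bounded X (topspace X) \<longleftrightarrow> sigma_compact_topology X"
proof -
  have "\<Union>\<K> \<subseteq> topspace X" if "\<forall>K\<in>\<K>. compactin X K" for \<K>
    using that compactin_subset_topspace by (meson Sup_least)
  then show ?thesis
    unfolding sigma_bounded_def sigma_compact_topology_def
    by (metis order_refl subset_antisym)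
qed

text \<open>A Cantor-Bendixson style argument: delete all open sets in which \<open>Z\<close> is
  sigma-bounded. By the countable base the deleted part \<open>W\<close> of \<open>Z\<close> is
  sigma-bounded too, so an open set with sigma-bounded trace on the rest was itself deleted.\<close>

lemma ex_nowhere_sigma_bounded_kernel:
  assumes X: "second_countable X" and Z: "closedin X Z" "\<not> sigma_bounded X Z"
  obtains S where "closedin X S" "S \<subseteq> Z" "S \<noteq> {}"
    "\<And>U. openin X U \<Longrightarrow> U \<inter> S \<noteq> {} \<Longrightarrow> \<not> sigma_bounded X (U \<inter> S)"
proof -
  define W where "W = \<Union>{V. openin X V \<and> sigma_bounded X (V \<inter> Z)}"
  obtain \<B> where \<B>: "countable \<B>" "\<forall>U x. openin X U \<and> x \<in> U \<longrightarrow> (\<exists>V\<in>\<B>. x \<in> V \<and> V \<subseteq> U)"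
    using X unfolding second_countable_def by auto
  define \<V> where "\<V> = {V \<in> \<B>. sigma_bounded X (V \<inter> Z)}"
  have "sigma_bounded X (\<Union>V\<in>\<V>. V \<inter> Z)"
    using \<B>(1) by (intro sigma_bounded_UN) (auto simp: \<V>_def)
  moreover have "W \<inter> Z \<subseteq> (\<Union>V\<in>\<V>. V \<inter> Z)"
  proof
    fix x assume x: "x \<in> W \<inter> Z"
    then obtain U where U: "openin X U" "x \<in> U" "sigma_bounded X (U \<inter> Z)"
      by (auto simp: W_def)
    then obtain V where V: "V \<in> \<B>" "x \<in> V" "V \<subseteq> U"
      using \<B>(2) by blast
    then have "V \<in> \<V>"
      using U(3) by (auto simp: \<V>_def intro: sigma_bounded_subset)
    with x V(2) show "x \<in> (\<Union>V\<in>\<V>. V \<inter> Z)" by blast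
  qed
  ultimately have W: "sigma_bounded X (W \<inter> Z)"
    by (rule sigma_bounded_subset)
  show thesis
  proof
    show "closedin X (Z - W)"
      using Z(1) by (intro closedin_diff) (auto simp: W_def)
    show "Z - W \<noteq> {}"
    proof
      assume "Z - W = {}"
      then have "Z \<subseteq> W \<inter> Z" by blast
      then show False
        using sigma_bounded_subset[OF W] Z(2) by simp
    qed
    fix U assume U: "openin X U" "U \<inter> (Z - W) \<noteq> {}"
    show "\<not> sigma_bounded X (U \<inter> (Z - W))"
    proof
      assume "sigma_bounded X (U \<inter> (Z - W))"
      with W have "sigma_bounded X (\<Union>A\<in>{U \<inter> (Z - W), W \<inter> Z}. A)"
        by (intro sigma_bounded_UN) auto
      then have "sigma_bounded X (U \<inter> Z)"
        by (rule sigma_bounded_subset) auto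
      then have "U \<subseteq> W"
        using U(1) by (auto simp: W_def)
      with U(2) show False by blast
    qed
  qed auto
qed

section \<open>The tree of balls\<close>

locale nowhere_locally_compact_kernel =
  D: Metric_space M d + R: Metric_space M \<rho> for M :: "'a set" and d and \<rho> +
  fixes S :: "'a set" and f :: "'a \<Rightarrow> real"
  assumes same_topology: "R.mtopology = D.mtopology"
    and complete: "R.mcomplete"
    and totally_bounded: "D.mtotally_bounded M"
    and closed: "closedin D.mtopology S"
    and nonempty: "S \<noteq> {}"
    and noncompact: "z \<in> S \<Longrightarrow> r > 0 \<Longrightarrow> \<not> compactin D.mtopology (R.mcball z r \<inter> S)"
    and continuous: "continuous_map D.mtopology euclideanreal f"
    and bounded: "bounded (f ` S)"
begin

text \<open>\<open>k\<close> is the depth of the parent; the bound on \<open>q n\<close> forces the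
  radii to 0 along every branch.\<close>

definition children :: "nat \<Rightarrow> 'a \<Rightarrow> real \<Rightarrow> (nat \<Rightarrow> 'a) \<Rightarrow> (nat \<Rightarrow> real) \<Rightarrow> bool" where
  "children k z r y q \<longleftrightarrow>
    (\<forall>n. y n \<in> S \<and> 0 < q n \<and> q n \<le> inverse (real (Suc k)) \<and>
      R.mcball (y n) (q n) \<subseteq> R.mcball z r) \<and>
    D.scattered f (\<lambda>n. R.mcball (y n) (q n) \<inter> S)"

lemma S_subset: "S \<subseteq> M"
  using closedin_subset[OF closed] by simp

lemma closedin_mcball_Int: "closedin D.mtopology (R.mcball z r \<inter> S)"
  using closed R.closedin_mcball[of z r] unfolding same_topology by (intro closedin_Int)

lemma ex_children:
  assumes z: "z \<in> S" and r: "r > 0"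
  shows "\<exists>y q. children k z r y q"
proof -
  \<comment> \<open>Centres within \<open>r / 2\<close> of \<open>z\<close> and radii at most
    \<open>r / 2\<close> keep the child balls inside the ball of radius \<open>r\<close>.\<close>
  define C where "C = R.mcball z (r / 2) \<inter> S"
  have "closedin D.mtopology C"
    unfolding C_def by (rule closedin_mcball_Int)
  moreover have "\<not> compactin D.mtopology C"
    using noncompact z r by (simp add: C_def)
  moreover have "D.mtotally_bounded C"
    using totally_bounded S_subset by (auto simp: C_def intro: D.mtotally_bounded_subset)
  moreover have "bounded (f ` C)"
    using bounded by (rule bounded_subset) (auto simp: C_def)
  ultimately obtain y where y: "range y \<subseteq> C" "inj y" "Cauchy (\<lambda>n. f (y n))"
    "\<And>p. p \<in> M \<Longrightarrow> \<exists>\<delta>>0. \<exists>N. \<forall>n\<ge>N. \<delta> \<le> d p (y n)"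
    by (rule D.ex_diverging_sequence) blast
  have yS: "y n \<in> S" and yM: "y n \<in> M" and yz: "\<rho> z (y n) \<le> r / 2" for n
  proof -
    have "y n \<in> C"
      using y(1) by blast
    then show "y n \<in> S" "y n \<in> M" "\<rho> z (y n) \<le> r / 2"
      using S_subset by (auto simp: C_def)
  qed
  have "range y \<subseteq> M"
    using yM by auto
  then obtain e where e: "\<And>n. e n > 0"
    "\<And>G. (\<And>n. G n \<subseteq> {x \<in> M. d (y n) x < e n \<and> \<bar>f x - f (y n)\<bar> < e n}) \<Longrightarrow>
      D.scattered f G"
    by (rule D.ex_separating_radii[of y f]) (use y(2-4) in auto)
  have ex_q: "\<forall>n. \<exists>q>0. q \<le> min (inverse (real (Suc k))) (r / 2) \<and>
      R.mcball (y n) q \<subseteq> {x \<in> M. d (y n) x < e n \<and> \<bar>f x - f (y n)\<bar> < e n}"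
  proof
    fix n
    \<comment> \<open>The passage from \<open>d\<close> and \<open>f\<close> to
      \<open>\<rho>\<close>: \<open>V\<close> is open in the common topology, hence contains a
      closed \<open>\<rho>\<close>-ball around \<open>y n\<close>.\<close>
    define V where "V = D.mball (y n) (e n) \<inter> {x \<in> M. f x \<in> ball (f (y n)) (e n)}"
    have "openin D.mtopology {x \<in> M. f x \<in> ball (f (y n)) (e n)}"
      using continuous open_ball unfolding continuous_map_def by fastforce
    then have "openin R.mtopology V"
      unfolding V_def same_topology by (intro openin_Int) auto
    moreover have "y n \<in> V"
      using e(1) yM by (simp add: V_def)
    ultimately obtain q where q: "q > 0" "R.mcball (y n) q \<subseteq> V"
      by (auto simp: R.openin_mtopology_mcball)
    define q' where "q' = min q (min (inverse (real (Suc k))) (r / 2))"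
    have "R.mcball (y n) q' \<subseteq> V"
      using q(2) by (auto simp: q'_def)
    moreover have "V \<subseteq> {x \<in> M. d (y n) x < e n \<and> \<bar>f x - f (y n)\<bar> < e n}"
      by (auto simp: V_def dist_real_def)
    moreover have "q' > 0"
      using q(1) r by (simp add: q'_def)
    ultimately show "\<exists>q>0. q \<le> min (inverse (real (Suc k))) (r / 2) \<and>
      R.mcball (y n) q \<subseteq> {x \<in> M. d (y n) x < e n \<and> \<bar>f x - f (y n)\<bar> < e n}"
      by (intro exI[of _ q']) (auto simp: q'_def)
  qed
  obtain q where q: "\<forall>n. q n > 0 \<and> q n \<le> min (inverse (real (Suc k))) (r / 2) \<and>
      R.mcball (y n) (q n) \<subseteq> {x \<in> M. d (y n) x < e n \<and> \<bar>f x - f (y n)\<bar> < e n}"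
    using choice[OF ex_q] ..
  have sub: "R.mcball (y n) (q n) \<subseteq> R.mcball z r" for n
  proof
    fix x assume x: "x \<in> R.mcball (y n) (q n)"
    have "z \<in> M"
      using z S_subset by blast
    with x have "\<rho> z x \<le> \<rho> z (y n) + \<rho> (y n) x"
      using R.triangle yM by simp
    also have "\<dots> \<le> r"
      using x yz[of n] q[rule_format, of n] by simp
    finally show "x \<in> R.mcball z r"
      using x \<open>z \<in> M\<close> by simp
  qed
  have "children k z r y q"
    unfolding children_def
  proof (intro conjI allI)
    show "D.scattered f (\<lambda>n. R.mcball (y n) (q n) \<inter> S)"
      by (rule e(2)) (use q in blast)
    show "q n \<le> inverse (real (Suc k))" for n
      using q[rule_format, of n] by simp
  qed (use yS q sub in auto)
  then show ?thesis by blast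
qed

lemma ex_irrationals:
  "\<exists>P. closedin D.mtopology P \<and> subtopology D.mtopology P homeomorphic_space Baire_topology \<and>
     (\<forall>\<epsilon>>0. \<exists>\<delta>>0. \<forall>x\<in>P. \<forall>y\<in>P. d x y < \<delta> \<longrightarrow> \<bar>f x - f y\<bar> < \<epsilon>)"
proof -
  \<comment> \<open>A total choice function, meaningful only for \<open>z\<close> in
    \<open>S\<close> and positive \<open>r\<close>; the induction over nodes maintains both.\<close>
  define w where "w k z r = (SOME p. children k z r (fst p) (snd p))" for k z r
  define y where "y k z r = fst (w k z r)" for k z r
  define q where "q k z r = snd (w k z r)" for k z r
  have yq: "children k z r (y k z r) (q k z r)" if zr: "z \<in> S" "r > 0" for k z r
  proof -
    obtain y' q' where "children k z r y' q'"
      using ex_children[OF zr] by blast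
    then show ?thesis
      using someI[of "\<lambda>p. children k z r (fst p) (snd p)" "(y', q')"]
      unfolding y_def q_def w_def by simp
  qed
  obtain z0 where z0: "z0 \<in> S"
    using nonempty by blast
  \<comment> \<open>A node is stored as centre and radius; the depth is read off the tail
    \<open>s\<close>. The root radius 1 below is arbitrary.\<close>
  define step where "step n s = (\<lambda>(z, r). (y (length s) z r n, q (length s) z r n))"
    for n :: nat and s :: "nat list"
  define node where "node = rec_list (z0, 1) (\<lambda>n s. step n s)"
  define c where "c s = fst (node s)" for s
  define \<eta> where "\<eta> s = snd (node s)" for s
  define F where "F s = R.mcball (c s) (\<eta> s) \<inter> S" for s
  have node: "c [] = z0" "\<eta> [] = 1" "c (n # s) = y (length s) (c s) (\<eta> s) n"
    "\<eta> (n # s) = q (length s) (c s) (\<eta> s) n" for n s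
    by (simp_all add: c_def \<eta>_def node_def step_def case_prod_beta)
  have "c s \<in> S \<and> \<eta> s > 0" for s
  proof (induction s)
    case (Cons n s)
    then show ?case
      using yq[of "c s" "\<eta> s" "length s"] by (simp add: node children_def)
  qed (simp add: node z0)
  then have c: "c s \<in> S" and \<eta>: "\<eta> s > 0" for s
    by blast+
  have ch: "children (length s) (c s) (\<eta> s) (\<lambda>n. c (n # s)) (\<lambda>n. \<eta> (n # s))" for s
    using yq[OF c \<eta>, of "length s" s s] by (simp add: node)
  have radius: "\<eta> (n # s) \<le> inverse (real (Suc (length s)))"
    and sub: "R.mcball (c (n # s)) (\<eta> (n # s)) \<subseteq> R.mcball (c s) (\<eta> s)" for n s
    using ch[of s] unfolding children_def by blast+
  have "D.scattered f (\<lambda>n. F (n # s))" for s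
    using ch[of s] unfolding children_def F_def by blast
  then have sep: "\<exists>\<delta>>0. \<forall>m. m \<noteq> n \<longrightarrow> (\<forall>x\<in>F (n # s). \<forall>x'\<in>F (m # s). \<delta> \<le> d x x')"
    and lf: "p \<in> M \<Longrightarrow> \<exists>\<delta>>0. \<exists>N. \<forall>n\<ge>N. \<forall>x\<in>F (n # s). \<delta> \<le> d p x"
    and tail: "\<epsilon> > 0 \<Longrightarrow>
      \<exists>N. \<forall>m\<ge>N. \<forall>n\<ge>N. \<forall>x\<in>F (m # s). \<forall>x'\<in>F (n # s). \<bar>f x - f x'\<bar> < \<epsilon>"
    for s n p \<epsilon>
    unfolding D.scattered_def by simp_all
  have Fclosed: "closedin D.mtopology (F s)" for s
    unfolding F_def by (rule closedin_mcball_Int)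
  have Fne: "F s \<noteq> {}" for s
  proof -
    have "c s \<in> M"
      using c S_subset by blast
    then have "c s \<in> F s"
      using c[of s] \<eta>[of s] by (simp add: F_def)
    then show ?thesis by blast
  qed
  have Fsub: "F (n # s) \<subseteq> F s" for n s
    using sub by (auto simp: F_def)
  have small: "\<exists>n. \<eta> (path b n) < \<epsilon>" if \<epsilon>: "\<epsilon> > 0" for b \<epsilon>
  proof -
    obtain n where "inverse (real (Suc n)) < \<epsilon>"
      using reals_Archimedean[OF \<epsilon>] by blast
    \<comment> \<open>A node at depth \<open>Suc n\<close> is a child of one at depth
      \<open>n\<close>, so its radius is at most \<open>1/(n+1)\<close>.\<close>
    then have "\<eta> (path b (Suc n)) < \<epsilon>"
      using radius[of "b n" "path b n"] by simp
    then show ?thesis by blast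
  qed
  have shrink: "\<exists>x. (\<forall>n. x \<in> F (path b n)) \<and>
      (\<forall>V. openin D.mtopology V \<and> x \<in> V \<longrightarrow> (\<exists>n. F (path b n) \<subseteq> V))" for b
  proof -
    have "decseq (\<lambda>n. F (path b n))"
      using Fsub by (simp add: decseq_Suc_iff)
    moreover have "\<exists>n a. F (path b n) \<subseteq> R.mcball a \<epsilon>" if \<epsilon>: "\<epsilon> > 0" for \<epsilon>
    proof -
      obtain n where "\<eta> (path b n) < \<epsilon>"
        using small[OF \<epsilon>] by blast
      then have "F (path b n) \<subseteq> R.mcball (c (path b n)) \<epsilon>"
        by (auto simp: F_def)
      then show ?thesis by blast
    qed
    \<comment> \<open>Cantor's intersection theorem for the complete metric
      \<open>\<rho>\<close>.\<close>
    ultimately have "\<Inter> (range (\<lambda>n. F (path b n))) \<noteq> {}"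
      using complete[unfolded R.mcomplete_nest, rule_format, of "\<lambda>n. F (path b n)"] Fclosed Fne
      by (simp add: same_topology)
    then obtain x where x: "\<And>n. x \<in> F (path b n)"
      by blast
    have "\<exists>n. F (path b n) \<subseteq> V" if V: "openin D.mtopology V" "x \<in> V" for V
    proof -
      obtain r where r: "r > 0" "R.mball x r \<subseteq> V"
        using V R.openin_mtopology[of V] by (auto simp: same_topology)
      obtain n where n: "\<eta> (path b n) < r / 2"
        using small[of "r / 2"] r(1) by auto
      have "w \<in> R.mball x r" if w: "w \<in> F (path b n)" for w
      proof -
        let ?c = "c (path b n)"
        have "\<rho> ?c x \<le> \<eta> (path b n)" "\<rho> ?c w \<le> \<eta> (path b n)" "x \<in> M" "w \<in> M" "?c \<in> M"
          using x[of n] w by (auto simp: F_def)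
        then show ?thesis
          using n R.triangle[of x ?c w] by (simp add: R.commute)
      qed
      with r(2) show ?thesis by blast
    qed
    with x show ?thesis by blast
  qed
  interpret T: separated_scheme M d F
  proof
    show "closedin D.mtopology (F s)" for s
      by (rule Fclosed)
    show "F (n # s) \<subseteq> F s" for n s
      by (rule Fsub)
  qed (use shrink sep lf in simp_all)
  show ?thesis
  proof (intro exI[of _ "range T.point"] conjI allI impI)
    show "closedin D.mtopology (range T.point)"
      by (rule T.closedin_range_point)
    show "subtopology D.mtopology (range T.point) homeomorphic_space Baire_topology"
      by (rule T.homeomorphic_Baire)
    show "\<exists>\<delta>>0. \<forall>x\<in>range T.point. \<forall>y\<in>range T.point. d x y < \<delta> \<longrightarrow> \<bar>f x - f y\<bar> < \<epsilon>"
      if "\<epsilon> > 0" for \<epsilon>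
      by (rule T.uniformly_continuous_on_range_point[OF continuous tail that])
  qed
qed

end

theorem theorem3p2:
  fixes X :: "'a topology" and d :: "'a \<Rightarrow> 'a \<Rightarrow> real" and f :: "'a \<Rightarrow> real"
  assumes "Polish_topology X"
    and "\<not> sigma_compact_topology X"
    and "compatible_metric X d"
    and "Metric_space.mtotally_bounded (topspace X) d (topspace X)"
    and "continuous_map X euclideanreal f"
  shows "\<exists>P. closedin X P \<and> subtopology X P homeomorphic_space Baire_topology \<and>
           uniformly_continuous_map (submetric (metric (topspace X, d)) P) euclidean_metric f"
proof -
  define M where "M = topspace X"
  interpret D: Metric_space M d
    using assms(3) by (simp add: compatible_metric_def M_def)
  have DX: "D.mtopology = X"
    using assms(3) by (simp add: compatible_metric_def M_def)
  obtain M' \<rho> where \<rho>: "Metric_space M' \<rho>" "Metric_space.mcomplete M' \<rho>"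
    "X = Metric_space.mtopology M' \<rho>"
    using assms(1) by (auto simp: Polish_topology_def completely_metrizable_space_def)
  have "M' = M"
    using \<rho>(1,3) Metric_space.topspace_mtopology by (auto simp: M_def)
  then interpret R: Metric_space M \<rho>
    using \<rho>(1) by simp
  have RX: "R.mtopology = X" and complete: "R.mcomplete"
    using \<rho> \<open>M' = M\<close> by simp_all
  have tb: "D.mtotally_bounded M"
    using assms(4) by (simp add: M_def)
  have sc: "second_countable X"
    using D.mtotally_bounded_imp_second_countable[OF tb] by (simp add: DX)
  define Z where "Z n = {x \<in> topspace X. f x \<in> {- real n..real n}}" for n :: nat
  have closedZ: "closedin X (Z n)" for n
    unfolding Z_def by (rule closedin_continuous_map_preimage[OF assms(5)]) simp
  have "topspace X \<subseteq> (\<Union>n. Z n)"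
  proof
    fix x assume "x \<in> topspace X"
    moreover obtain n :: nat where "\<bar>f x\<bar> \<le> real n"
      using real_arch_simple by blast
    ultimately show "x \<in> (\<Union>n. Z n)"
      by (auto simp: Z_def abs_le_iff intro!: exI[of _ n])
  qed
  then have "\<not> sigma_bounded X (\<Union>n. Z n)"
    using assms(2) sigma_bounded_subset sigma_bounded_topspace by metis
  then obtain n where n: "\<not> sigma_bounded X (Z n)"
    using sigma_bounded_UN[of UNIV X Z] by auto
  obtain S where S: "closedin X S" "S \<subseteq> Z n" "S \<noteq> {}"
    "\<And>U. openin X U \<Longrightarrow> U \<inter> S \<noteq> {} \<Longrightarrow> \<not> sigma_bounded X (U \<inter> S)"
    using ex_nowhere_sigma_bounded_kernel[OF sc closedZ n] by blast
  \<comment> \<open>A compact closed ball in \<open>S\<close> would cover the open ball, whose trace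
    on \<open>S\<close> contains \<open>z\<close> and so is not sigma-bounded.\<close>
  have "\<not> compactin X (R.mcball z r \<inter> S)" if "z \<in> S" "r > 0" for z r
  proof
    assume "compactin X (R.mcball z r \<inter> S)"
    then have "sigma_bounded X (R.mball z r \<inter> S)"
      using sigma_bounded_compactin sigma_bounded_subset R.mball_subset_mcball
      by (metis Int_mono order_refl)
    moreover have "z \<in> M"
      using \<open>z \<in> S\<close> closedin_subset[OF S(1)] by (auto simp: M_def)
    then have "z \<in> R.mball z r"
      using \<open>r > 0\<close> by simp
    moreover have "openin X (R.mball z r)"
      using R.openin_mball by (simp add: RX)
    ultimately show False
      using S(4) \<open>z \<in> S\<close> by blast
  qed
  moreover have "bounded (f ` S)"
    by (rule bounded_subset[of "{- real n..real n}"]) (use S(2) in \<open>auto simp: Z_def\<close>)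
  ultimately interpret nowhere_locally_compact_kernel M d \<rho> S f
    using S assms(5) complete tb by unfold_locales (auto simp: DX RX)
  obtain P where P: "closedin X P" "subtopology X P homeomorphic_space Baire_topology"
    "\<And>\<epsilon>. \<epsilon> > 0 \<Longrightarrow> \<exists>\<delta>>0. \<forall>x\<in>P. \<forall>y\<in>P. d x y < \<delta> \<longrightarrow> \<bar>f x - f y\<bar> < \<epsilon>"
    using ex_irrationals unfolding DX by blast
  have "uniformly_continuous_map (submetric (metric (M, d)) P) euclidean_metric f"
    unfolding uniformly_continuous_map_def
  proof (intro conjI strip)
    fix \<epsilon> :: real assume "\<epsilon> > 0"
    then obtain \<delta> where "\<delta> > 0" "\<forall>x\<in>P. \<forall>y\<in>P. d x y < \<delta> \<longrightarrow> \<bar>f x - f y\<bar> < \<epsilon>"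
      using P(3) by blast
    then show "\<exists>\<delta>>0. \<forall>x\<in>mspace (submetric (metric (M, d)) P).
        \<forall>y\<in>mspace (submetric (metric (M, d)) P).
          mdist (submetric (metric (M, d)) P) y x < \<delta> \<longrightarrow> mdist euclidean_metric (f y) (f x) < \<epsilon>"
      by (intro exI[of _ \<delta>]) (simp add: dist_real_def)
  qed simp
  with P(1,2) show ?thesis
    unfolding M_def by (intro exI[of _ P] conjI)
qed

end
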